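(* Let $X$ be a connected finite polyhedron, let $f:X\to D_n(X)$ be an $n$-valued map, and let $\bar f=(\bar f_1,\dots,\bar f_n):\tilde X\to F_n(\tilde X,\pi)$ be the basic lifting of $f$. Let $\{\bar f_{i_1},\dots,\bar f_{i_k}\}\subset\{\bar f_1,\dots,\bar f_n\}$ be a $\sigma$-class (with $k$ elements), and let $\bar g=(\bar f_{i_1},\dots,\bar f_{i_k})$. Then there is a $k$-valued submap $g:X\to D_k(X)$ of $f$ which lifts to $\bar g$, i.e. $g(p(\tilde x))=\{p(\bar f_{i_1}(\tilde x)),\dots,p(\bar f_{i_k}(\tilde x))\}$ for all $\tilde x\in\tilde X$.
   Context: For a space $Y$, $F_n(Y)=\{(y_1,\dots,y_n)\in Y^n\mid y_i\ne y_j \text{ for } i\neq j\}$ with the subspace topology, and $D_n(Y)=F_n(Y)/\Sigma_n$ (unordered $n$-element subsets) with the quotient topology. An $n$-valued map is a continuous function $f:X\to D_n(Y)$. A submap of $f$ is a $k$-valued map $g:X\to D_k(Y)$ ($k\le n$) with $g(x)\subseteq f(x)$ for all $x$. Let $p:\tilde X\to X$ be the universal covering, with $\pi_1(X)$ acting on $\tilde X$ by covering transformations. The orbit configuration space is $F_n(\tilde X,\pi)=\{(\tilde x_1,\dots,\tilde x_n)\in\tilde X^n\mid p(\tilde x_i)\neq p(\tilde x_j)\text{ for } i\neq j\}$; applying $p$ to each coordinate gives a covering map $p^n:F_n(\tilde X,\pi)\to D_n(X)$. Fixing basepoints of $\tilde X$ and $F_n(\tilde X,\pi)$ (the latter lying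 over the image under $f\circ p$ of the former), the basic lifting of $f$ is the unique basepoint-preserving continuous map $\bar f=(\bar f_1,\dots,\bar f_n):\tilde X\to F_n(\tilde X,\pi)$ with $p^n\circ\bar f=f\circ p$. There are uniquely determined functions $\phi_i:\pi_1(X)\to\pi_1(X)$ ($1\le i\le n$) and a homomorphism $\sigma:\pi_1(X)\to\Sigma_n$, $\alpha\mapsto\sigma_\alpha$, such that $\bar f_i(\alpha\tilde x)=\phi_i(\alpha)\bar f_{\sigma_\alpha^{-1}(i)}(\tilde x)$ for all $\alpha\in\pi_1(X)$, $\tilde x\in\tilde X$ and all $i$. For $i,j\in\{1,\dots,n\}$ write $i\sim j$ if $\sigma_\gamma(j)=i$ for some $\gamma\in\pi_1(X)$; this is an equivalence relation. The $\sigma$-classes of $\bar f$ are the corresponding equivalence classes in $\{\bar f_1,\dots,\bar f_n\}$, where $\bar f_i,\bar f_j$ are in the same class when $i\sim j$. *)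

theory Defs
  imports "HOL-Analysis.Analysis" "HOL-Algebra.Sym_Groups"
begin

subsection \<open>Configuration spaces\<close>

text \<open>Points of a power \<open>Y\<^sup>n\<close> are extensional functions on \<open>{1..n}\<close>.\<close>

definition quotient_topology :: "'a topology \<Rightarrow> ('a \<Rightarrow> 'b) \<Rightarrow> 'b topology" where
  "quotient_topology T q =
     topology (\<lambda>U. U \<subseteq> q ` topspace T \<and> openin T {x \<in> topspace T. q x \<in> U})"

lemma openin_quotient_topology:
  "openin (quotient_topology T q) U \<longleftrightarrow>
     U \<subseteq> q ` topspace T \<and> openin T {x \<in> topspace T. q x \<in> U}"
proof -
  have "istopology (\<lambda>U. U \<subseteq> q ` topspace T \<and> openin T {x \<in> topspace T. q x \<in> U})"
    unfolding istopology_def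
  proof (intro conjI allI impI)
    fix S U
    assume S: "S \<subseteq> q ` topspace T \<and> openin T {x \<in> topspace T. q x \<in> S}"
      and U: "U \<subseteq> q ` topspace T \<and> openin T {x \<in> topspace T. q x \<in> U}"
    show "S \<inter> U \<subseteq> q ` topspace T" using S by blast
    have "{x \<in> topspace T. q x \<in> S \<inter> U} =
        {x \<in> topspace T. q x \<in> S} \<inter> {x \<in> topspace T. q x \<in> U}" by blast
    then show "openin T {x \<in> topspace T. q x \<in> S \<inter> U}"
      using S U by (simp only: openin_Int)
  next
    fix \<K>
    assume K: "\<forall>K\<in>\<K>. K \<subseteq> q ` topspace T \<and> openin T {x \<in> topspace T. q x \<in> K}"
    show "\<Union>\<K> \<subseteq> q ` topspace T" using K by blast
    have "{x \<in> topspace T. q x \<in> \<Union>\<K>} = (\<Union>K\<in>\<K>. {x \<in> topspace T. q x \<in> K})" by blast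
    then show "openin T {x \<in> topspace T. q x \<in> \<Union>\<K>}"
      using K by (simp only:) (rule openin_Union, blast)
  qed
  then show ?thesis
    unfolding quotient_topology_def by (simp only: topology_inverse')
qed

lemma topspace_quotient_topology: "topspace (quotient_topology T q) = q ` topspace T"
proof (rule antisym)
  show "topspace (quotient_topology T q) \<subseteq> q ` topspace T"
    using openin_topspace[of "quotient_topology T q"] unfolding openin_quotient_topology
    by (rule conjunct1)
  have "{x \<in> topspace T. q x \<in> q ` topspace T} = topspace T" by blast
  then have "openin (quotient_topology T q) (q ` topspace T)"
    by (simp add: openin_quotient_topology)
  then show "q ` topspace T \<subseteq> topspace (quotient_topology T q)"
    by (rule openin_subset)
qed

lemma quotient_map_quotient_topology: "quotient_map T (quotient_topology T q) q"
  unfolding quotient_map_def topspace_quotient_topology openin_quotient_topology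
  by simp

definition config_space :: "'a::topological_space set \<Rightarrow> nat \<Rightarrow> (nat \<Rightarrow> 'a) topology" where
  "config_space Y n =
     subtopology (product_topology (\<lambda>_. top_of_set Y) {1..n}) {y. inj_on y {1..n}}"

text \<open>Two configurations lie in the same orbit of the symmetric group iff they have the same
  underlying set, so the orbit of \<open>y\<close> is represented by the set \<open>y ` {1..n}\<close>.\<close>

definition unordered_config_space :: "'a::topological_space set \<Rightarrow> nat \<Rightarrow> 'a set topology" where
  "unordered_config_space Y n = quotient_topology (config_space Y n) (\<lambda>y. y ` {1..n})"

definition multivalued_map :: "'a::topological_space set \<Rightarrow> nat \<Rightarrow> ('a \<Rightarrow> 'a set) \<Rightarrow> bool" where
  "multivalued_map X n f \<longleftrightarrow> continuous_map (top_of_set X) (unordered_config_space X n) f"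

definition submap ::
  "'a::topological_space set \<Rightarrow> nat \<Rightarrow> ('a \<Rightarrow> 'a set) \<Rightarrow> nat \<Rightarrow> ('a \<Rightarrow> 'a set) \<Rightarrow> bool" where
  "submap X n f k g \<longleftrightarrow> k \<le> n \<and> multivalued_map X k g \<and> (\<forall>x\<in>X. g x \<subseteq> f x)"


subsection \<open>The fundamental group and its action on the universal covering\<close>

definition loops_at :: "'a::topological_space set \<Rightarrow> 'a \<Rightarrow> (real \<Rightarrow> 'a) set" where
  "loops_at X x = {\<gamma>. path \<gamma> \<and> path_image \<gamma> \<subseteq> X \<and> pathstart \<gamma> = x \<and> pathfinish \<gamma> = x}"

definition path_class :: "'a::topological_space set \<Rightarrow> (real \<Rightarrow> 'a) \<Rightarrow> (real \<Rightarrow> 'a) set" where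
  "path_class X \<gamma> = {\<delta>. homotopic_paths X \<gamma> \<delta>}"

definition fundamental_group ::
  "'a::topological_space set \<Rightarrow> 'a \<Rightarrow> (real \<Rightarrow> 'a) set monoid" where
  "fundamental_group X x =
     \<lparr> carrier = path_class X ` loops_at X x,
       mult = (\<lambda>A B. \<Union>\<gamma>\<in>A. \<Union>\<delta>\<in>B. path_class X (\<gamma> +++ \<delta>)),
       one = path_class X (\<lambda>_. x) \<rparr>"

definition universal_covering ::
  "'b::topological_space set \<Rightarrow> ('b \<Rightarrow> 'a::topological_space) \<Rightarrow> 'a set \<Rightarrow> bool" where
  "universal_covering E p X \<longleftrightarrow> covering_space E p X \<and> simply_connected E"

definition covering_transformation ::
  "'b::topological_space set \<Rightarrow> ('b \<Rightarrow> 'a) \<Rightarrow> ('b \<Rightarrow> 'b) \<Rightarrow> bool" where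
  "covering_transformation E p D \<longleftrightarrow>
     (\<exists>D'. homeomorphism E E D D') \<and> (\<forall>e\<in>E. p (D e) = p e)"

text \<open>The standard action determined by the basepoint \<open>e0\<close>: the class of a loop acts as the covering
  transformation taking \<open>e0\<close> to the endpoint of the lift of that loop starting at \<open>e0\<close>. As \<open>E\<close> is
  connected, this determines \<open>act \<alpha>\<close> on \<open>E\<close>; with \<open>+++\<close> as product it is a left action.\<close>

definition covering_action ::
  "'b::topological_space set \<Rightarrow> ('b \<Rightarrow> 'a::topological_space) \<Rightarrow> 'a set \<Rightarrow> 'b \<Rightarrow>
     ((real \<Rightarrow> 'a) set \<Rightarrow> 'b \<Rightarrow> 'b) \<Rightarrow> bool" where
  "covering_action E p X e0 act \<longleftrightarrow>
     (\<forall>\<alpha> \<in> carrier (fundamental_group X (p e0)).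
        covering_transformation E p (act \<alpha>) \<and>
        (\<forall>\<gamma>\<in>\<alpha>. \<forall>\<delta>. path \<delta> \<and> path_image \<delta> \<subseteq> E \<and> pathstart \<delta> = e0 \<and> (\<forall>t\<in>{0..1}. p (\<delta> t) = \<gamma> t)
            \<longrightarrow> act \<alpha> e0 = pathfinish \<delta>))"


subsection \<open>Liftings and their classes\<close>

definition orbit_config_space ::
  "'b::topological_space set \<Rightarrow> ('b \<Rightarrow> 'a) \<Rightarrow> nat \<Rightarrow> (nat \<Rightarrow> 'b) topology" where
  "orbit_config_space E p n =
     subtopology (product_topology (\<lambda>_. top_of_set E) {1..n}) {y. inj_on (\<lambda>i. p (y i)) {1..n}}"

definition orbit_config_proj :: "('b \<Rightarrow> 'a) \<Rightarrow> nat \<Rightarrow> (nat \<Rightarrow> 'b) \<Rightarrow> 'a set" where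
  "orbit_config_proj p n y = (\<lambda>i. p (y i)) ` {1..n}"

definition lifting ::
  "'b::topological_space set \<Rightarrow> ('b \<Rightarrow> 'a) \<Rightarrow> nat \<Rightarrow> ('a \<Rightarrow> 'a set) \<Rightarrow> ('b \<Rightarrow> nat \<Rightarrow> 'b) \<Rightarrow> bool" where
  "lifting E p n f F \<longleftrightarrow>
     continuous_map (top_of_set E) (orbit_config_space E p n) F \<and>
     (\<forall>e\<in>E. orbit_config_proj p n (F e) = f (p e))"

definition basic_lifting ::
  "'b::topological_space set \<Rightarrow> ('b \<Rightarrow> 'a) \<Rightarrow> nat \<Rightarrow> 'b \<Rightarrow> (nat \<Rightarrow> 'b) \<Rightarrow> ('a \<Rightarrow> 'a set) \<Rightarrow>
     ('b \<Rightarrow> nat \<Rightarrow> 'b) \<Rightarrow> bool" where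
  "basic_lifting E p n e0 b f F \<longleftrightarrow> lifting E p n f F \<and> F e0 = b"

definition lifting_factors ::
  "'b set \<Rightarrow> 'g monoid \<Rightarrow> ('g \<Rightarrow> 'b \<Rightarrow> 'b) \<Rightarrow> nat \<Rightarrow> ('b \<Rightarrow> nat \<Rightarrow> 'b) \<Rightarrow>
     (nat \<Rightarrow> 'g \<Rightarrow> 'g) \<Rightarrow> ('g \<Rightarrow> nat \<Rightarrow> nat) \<Rightarrow> bool" where
  "lifting_factors E G act n F \<phi> \<sigma> \<longleftrightarrow>
     (\<forall>i\<in>{1..n}. \<phi> i \<in> carrier G \<rightarrow> carrier G) \<and>
     \<sigma> \<in> hom G (sym_group n) \<and>
     (\<forall>\<alpha>\<in>carrier G. \<forall>e\<in>E. \<forall>i\<in>{1..n}.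
        F (act \<alpha> e) i = act (\<phi> i \<alpha>) (F e (inv_into UNIV (\<sigma> \<alpha>) i)))"

definition sigma_rel :: "'g monoid \<Rightarrow> nat \<Rightarrow> ('g \<Rightarrow> nat \<Rightarrow> nat) \<Rightarrow> (nat \<times> nat) set" where
  "sigma_rel G n \<sigma> =
     {(i, j). i \<in> {1..n} \<and> j \<in> {1..n} \<and> (\<exists>\<gamma>\<in>carrier G. \<sigma> \<gamma> j = i)}"

definition component_map :: "'b set \<Rightarrow> ('b \<Rightarrow> nat \<Rightarrow> 'b) \<Rightarrow> nat \<Rightarrow> 'b \<Rightarrow> 'b" where
  "component_map E F i = (\<lambda>e\<in>E. F e i)"

definition sigma_classes ::
  "'b set \<Rightarrow> 'g monoid \<Rightarrow> nat \<Rightarrow> ('g \<Rightarrow> nat \<Rightarrow> nat) \<Rightarrow> ('b \<Rightarrow> nat \<Rightarrow> 'b) \<Rightarrow> ('b \<Rightarrow> 'b) set set" where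
  "sigma_classes E G n \<sigma> F = (\<lambda>J. component_map E F ` J) ` ({1..n} // sigma_rel G n \<sigma>)"

end

theory Submission
  imports Defs
begin

text \<open>The fundamental group acts transitively on the fibres of \<open>p\<close>, and moving along a fibre by \<open>\<alpha>\<close>
  permutes the points \<open>p (F e i)\<close> by \<open>\<sigma> \<alpha>\<close>, since the factors \<open>\<phi> i \<alpha>\<close> act by covering
  transformations and are killed by \<open>p\<close>. A \<open>\<sigma>\<close>-class is stable under these permutations, so its set of
  values is constant on fibres and descends to \<open>X\<close>, continuously because \<open>p\<close> is a quotient map.\<close>

section \<open>Covering spaces over arbitrary topological spaces\<close>

text \<open>The library proves open maps, unique lifting and path lifting for coverings only in metric or
  normed spaces; the total space here carries no such structure.\<close>

lemma covering_space_evenly_covered: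
  assumes "covering_space E p X" "x \<in> X"
  obtains T \<V> where "x \<in> T" "openin (top_of_set X) T" "\<Union>\<V> = E \<inter> p -` T"
    "\<And>V. V \<in> \<V> \<Longrightarrow> openin (top_of_set E) V" "pairwise disjnt \<V>"
    "\<And>V. V \<in> \<V> \<Longrightarrow> \<exists>q. homeomorphism V T p q"
  using assms unfolding covering_space_def by meson

text \<open>Openness is local: on a sheet \<open>V\<close> the map \<open>p\<close> is a
  homeomorphism onto an open set \<open>T\<close>, so the image of \<open>U \<inter> V\<close> is
  open in \<open>T\<close>, hence in \<open>X\<close>.\<close>

lemma covering_space_open_map_top:
  assumes cov: "covering_space E p X" and U: "openin (top_of_set E) U"
  shows "openin (top_of_set X) (p ` U)"
proof (subst openin_subopen, intro ballI)
  fix y assume "y \<in> p ` U"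
  then obtain e where e: "e \<in> U" "y = p e" by blast
  have "e \<in> E" using U e openin_imp_subset by blast
  then have "y \<in> X" using cov e covering_space_imp_surjective by blast
  then obtain T \<V> where T: "y \<in> T" "openin (top_of_set X) T" "\<Union>\<V> = E \<inter> p -` T"
    "\<And>V. V \<in> \<V> \<Longrightarrow> openin (top_of_set E) V" 
    "\<And>V. V \<in> \<V> \<Longrightarrow> \<exists>q. homeomorphism V T p q"
    using covering_space_evenly_covered[OF cov] by metis
  then obtain V where V: "V \<in> \<V>" "e \<in> V" using \<open>e \<in> E\<close> e by blast
  then obtain q where q: "homeomorphism V T p q" using T by blast
  have "V \<subseteq> E" using T(4)[OF V(1)] openin_imp_subset by blast
  have "openin (top_of_set E) (U \<inter> V)" using U T(4)[OF V(1)] by (rule openin_Int)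
  then have "openin (top_of_set V) (U \<inter> V)"
    using \<open>V \<subseteq> E\<close> by (meson inf_le2 openin_subset_trans)
  then have "openin (top_of_set T) (p ` (U \<inter> V))"
    by (rule homeomorphism_imp_open_map[OF q])
  then have "openin (top_of_set X) (p ` (U \<inter> V))" using T(2) openin_trans by blast
  then show "\<exists>W. openin (top_of_set X) W \<and> y \<in> W \<and> W \<subseteq> p ` U"
    using e V by blast
qed

lemma covering_space_quotient_map_top:
  assumes "covering_space E p X"
  shows "quotient_map (top_of_set E) (top_of_set X) p"
proof (rule continuous_open_imp_quotient_map)
  show "continuous_map (top_of_set E) (top_of_set X) p"
    using assms unfolding covering_space_def by auto
  show "open_map (top_of_set E) (top_of_set X) p"
    using covering_space_open_map_top[OF assms] unfolding open_map_def by blast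
  show "p ` topspace (top_of_set E) = topspace (top_of_set X)"
    using covering_space_imp_surjective[OF assms] by simp
qed

section \<open>Existence and uniqueness of path lifts\<close>

text \<open>Converts an open condition on \<open>g\<close> into a radius around \<open>t\<close>, as
  the local hypothesis of \<open>Bolzano\<close> requires.\<close>

lemma continuous_on_interval_nhd:
  fixes g :: "real \<Rightarrow> 'a::topological_space"
  assumes "continuous_on {a..b} g" "g ` {a..b} \<subseteq> X" "openin (top_of_set X) T"
    and "t \<in> {a..b}" "g t \<in> T"
  obtains d where "d > 0" "\<And>s. s \<in> {a..b} \<Longrightarrow> \<bar>s - t\<bar> < d \<Longrightarrow> g s \<in> T"
proof -
  have "openin (top_of_set {a..b}) ({a..b} \<inter> g -` T)"
    using assms by (intro continuous_openin_preimage) auto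
  then obtain d where "d > 0" "ball t d \<inter> {a..b} \<subseteq> {a..b} \<inter> g -` T"
    using assms(4,5) unfolding openin_contains_ball by blast
  then show thesis
    by (intro that[of d]) (force simp: dist_real_def abs_minus_commute)+
qed

text \<open>Short intervals map into evenly covered sets, where lifts exist, and lifts over adjacent
  intervals can be concatenated; \<open>Bolzano\<close> then yields a lift over all of
  \<open>{a..b}\<close>.\<close>

lemma covering_space_lift_interval:
  fixes g :: "real \<Rightarrow> 'a::topological_space"
  assumes cov: "covering_space E p X" and "a \<le> b"
    and cont: "continuous_on {a..b} g" and im: "g ` {a..b} \<subseteq> X" and "e \<in> E" "p e = g a"
  shows "\<exists>h. continuous_on {a..b} h \<and> h ` {a..b} \<subseteq> E \<and> h a = e \<and> (\<forall>t\<in>{a..b}. p (h t) = g t)"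
proof -
  define L where "L u v e h \<longleftrightarrow> continuous_on {u..v} h \<and> h ` {u..v} \<subseteq> E \<and> h u = e \<and>
      (\<forall>t\<in>{u..v}. p (h t) = g t)" for u v :: real and e and h :: "real \<Rightarrow> 'b"
  \<comment> \<open>Every starting point over \<open>g u\<close> is allowed, because a second lift
    must start wherever the first one ends.\<close>
  define P where "P u v \<longleftrightarrow> (a \<le> u \<longrightarrow> u \<le> v \<longrightarrow> v \<le> b \<longrightarrow>
      (\<forall>e\<in>E. p e = g u \<longrightarrow> (\<exists>h. L u v e h)))" for u v
  have "P a b" using \<open>a \<le> b\<close>
  proof (induction rule: Bolzano)
    case (trans u v w)
    show ?case unfolding P_def
    proof (intro impI ballI)
      fix e assume A: "a \<le> u" "u \<le> w" "w \<le> b" "e \<in> E" "p e = g u"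
      then obtain h where h: "L u v e h"
        using trans unfolding P_def by force
      then have hv: "h v \<in> E" "p (h v) = g v"
        using trans unfolding L_def by auto
      then obtain k where k: "L v w (h v) k"
        using trans A unfolding P_def by force
      \<comment> \<open>The pieces agree at \<open>v\<close> since \<open>k\<close> starts at
        \<open>h v\<close>.\<close>
      let ?l = "\<lambda>t. if t \<le> v then h t else k t"
      have "{t \<in> {u..w}. t \<le> v} = {u..v}" "{t \<in> {u..w}. v \<le> t} = {v..w}"
        using trans by auto
      then have "continuous_on {u..w} ?l"
        using h k unfolding L_def by (intro continuous_on_cases_1) auto
      then have "L u w e ?l"
        using h k trans unfolding L_def by (auto simp: image_subset_iff)
      then show "\<exists>h. L u w e h" by blast
    qed
  next
    case (local x)
    then have x: "x \<in> {a..b}" by simp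
    then have "g x \<in> X" using im by blast
    then obtain T \<V> where T: "g x \<in> T" "openin (top_of_set X) T" "\<Union>\<V> = E \<inter> p -` T"
      "\<And>V. V \<in> \<V> \<Longrightarrow> openin (top_of_set E) V" 
      "\<And>V. V \<in> \<V> \<Longrightarrow> \<exists>q. homeomorphism V T p q"
      using covering_space_evenly_covered[OF cov] by metis
    obtain d where d: "d > 0" "\<And>s. s \<in> {a..b} \<Longrightarrow> \<bar>s - x\<bar> < d \<Longrightarrow> g s \<in> T"
      using continuous_on_interval_nhd[OF cont im T(2) x T(1)] by blast
    have "P u v" if uv: "u \<le> x" "x \<le> v" "v - u < d" for u v
      unfolding P_def
    proof (intro impI ballI)
      fix e assume A: "a \<le> u" "u \<le> v" "v \<le> b" "e \<in> E" "p e = g u"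
      have gT: "g s \<in> T" if "s \<in> {u..v}" for s
        using that uv A by (intro d(2)) auto
      then have "e \<in> E \<inter> p -` T" using A by auto
      then obtain V where V: "V \<in> \<V>" "e \<in> V" using T(3) by blast
      then obtain q where q: "homeomorphism V T p q" using T by blast
      have "V \<subseteq> E" using T(4)[OF V(1)] openin_imp_subset by blast
      \<comment> \<open>The local lift is \<open>g\<close> followed by the inverse \<open>q\<close>
        of \<open>p\<close> on the sheet through \<open>e\<close>.\<close>
      have "continuous_on {u..v} (q \<circ> g)"
      proof (rule continuous_on_compose)
        show "continuous_on {u..v} g" using cont A by (auto intro: continuous_on_subset)
        show "continuous_on (g ` {u..v}) q"
          using q gT by (auto simp: homeomorphism_def intro: continuous_on_subset)
      qed
      moreover have "q (g s) \<in> V" "p (q (g s)) = g s" if "s \<in> {u..v}" for s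
        using q gT[OF that] by (auto simp: homeomorphism_def)
      moreover have "q (g u) = e"
        using q V A(5) homeomorphism_apply1 by metis
      ultimately have "L u v e (q \<circ> g)"
        using \<open>V \<subseteq> E\<close> unfolding L_def by auto
      then show "\<exists>h. L u v e h" by blast
    qed
    then show ?case using d(1) by blast
  qed
  then show ?thesis using assms unfolding P_def L_def by auto
qed

corollary covering_space_lift_path_top:
  assumes "covering_space E p X" "path g" "path_image g \<subseteq> X" "e \<in> E" "p e = pathstart g"
  obtains h where "path h" "path_image h \<subseteq> E" "pathstart h = e" "\<And>t. t \<in> {0..1} \<Longrightarrow> p (h t) = g t"
  using covering_space_lift_interval[of E p X 0 1 g e] assms
  unfolding path_def path_image_def pathstart_def by auto

text \<open>On a short interval \<open>h\<close> and \<open>k\<close> each stay in one sheet; a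
  common start makes the sheets equal, and \<open>p\<close> is injective on a sheet.
  \<open>Bolzano\<close> extends this to \<open>{a..b}\<close>.\<close>

lemma covering_space_lift_interval_unique:
  fixes h k :: "real \<Rightarrow> 'b::topological_space"
  assumes cov: "covering_space E p X" and "a \<le> b"
    and h: "continuous_on {a..b} h" "h ` {a..b} \<subseteq> E"
    and k: "continuous_on {a..b} k" "k ` {a..b} \<subseteq> E"
    and eq: "\<And>t. t \<in> {a..b} \<Longrightarrow> p (h t) = p (k t)" and "h a = k a"
  shows "h b = k b"
proof -
  define P where "P u v \<longleftrightarrow> (a \<le> u \<longrightarrow> u \<le> v \<longrightarrow> v \<le> b \<longrightarrow> h u = k u \<longrightarrow> h v = k v)" for u v
  have "P a b" using \<open>a \<le> b\<close>
  proof (induction rule: Bolzano)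
    case (trans u v w)
    then show ?case unfolding P_def by auto
  next
    case (local x)
    then have x: "x \<in> {a..b}" by simp
    then have hx: "h x \<in> E" and kx: "k x \<in> E" using h k by auto
    then have "p (h x) \<in> X" using covering_space_imp_surjective[OF cov] by blast
    then obtain T \<V> where T: "p (h x) \<in> T" "\<Union>\<V> = E \<inter> p -` T"
      "\<And>V. V \<in> \<V> \<Longrightarrow> openin (top_of_set E) V" "pairwise disjnt \<V>"
      "\<And>V. V \<in> \<V> \<Longrightarrow> \<exists>q. homeomorphism V T p q"
      using covering_space_evenly_covered[OF cov] by metis
    \<comment> \<open>Two sheets are taken because agreement is assumed only at the left end
      \<open>u\<close> of a subinterval, not at \<open>x\<close>.\<close>
    obtain V W where V: "V \<in> \<V>" "h x \<in> V" and W: "W \<in> \<V>" "k x \<in> W"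
      using T(1,2) hx kx eq[OF x] by (metis IntI UnionE vimageI2)
    obtain d where d: "d > 0" "\<And>s. s \<in> {a..b} \<Longrightarrow> \<bar>s - x\<bar> < d \<Longrightarrow> h s \<in> V"
      using continuous_on_interval_nhd[OF h T(3)[OF V(1)] x V(2)] by blast
    obtain d' where d': "d' > 0" "\<And>s. s \<in> {a..b} \<Longrightarrow> \<bar>s - x\<bar> < d' \<Longrightarrow> k s \<in> W"
      using continuous_on_interval_nhd[OF k T(3)[OF W(1)] x W(2)] by blast
    have "P u v" if uv: "u \<le> x" "x \<le> v" "v - u < min d d'" for u v
      unfolding P_def
    proof (intro impI)
      assume A: "a \<le> u" "u \<le> v" "v \<le> b" "h u = k u"
      have "h u \<in> V" "h v \<in> V" "k u \<in> W" "k v \<in> W"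
        using uv A(1-3) by (auto intro!: d(2) d'(2))
      \<comment> \<open>\<open>V\<close> and \<open>W\<close> share the point
        \<open>h u = k u\<close>, and distinct sheets are disjoint.\<close>
      then have "W = V" using T(4) V W A(4) by (metis disjnt_iff pairwiseD)
      moreover obtain q where "homeomorphism V T p q" using T(5) V by blast
      ultimately show "h v = k v"
        using \<open>h v \<in> V\<close> \<open>k v \<in> W\<close> eq[of v] A by (metis atLeastAtMost_iff homeomorphism_apply1 order_trans)
    qed
    then show ?case using d(1) d'(1) by (intro exI[of _ "min d d'"]) auto
  qed
  then show ?thesis using assms unfolding P_def by auto
qed

corollary covering_space_lift_path_unique:
  assumes "covering_space E p X" "path h" "path_image h \<subseteq> E" "path k" "path_image k \<subseteq> E"
    and "\<And>t. t \<in> {0..1} \<Longrightarrow> p (h t) = p (k t)" "pathstart h = pathstart k"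
  shows "pathfinish h = pathfinish k"
  using covering_space_lift_interval_unique[of E p X 0 1 h k] assms
  unfolding path_def path_image_def pathstart_def pathfinish_def by auto

text \<open>Any two loops in a simply connected set are freely homotopic; for constant loops, the
  track of one parameter under the homotopy joins \<open>x\<close> to \<open>y\<close>.\<close>

lemma simply_connected_imp_path_connected_top:
  fixes S :: "'a::topological_space set"
  assumes "simply_connected S"
  shows "path_connected S"
  unfolding path_connected_def
proof (intro ballI)
  fix x y assume xy: "x \<in> S" "y \<in> S"
  have "homotopic_loops S (\<lambda>_. x) (\<lambda>_. y)"
    using assms[unfolded simply_connected_def, rule_format, of "\<lambda>_. x" "\<lambda>_. y"] xy
    by (simp add: path_def path_image_def pathstart_def pathfinish_def image_subset_iff)
  then obtain h where h: "continuous_on ({0..1} \<times> {0..1}) h" "h \<in> ({0..1} \<times> {0..1}) \<rightarrow> S"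
      "\<And>t. t \<in> {0..1::real} \<Longrightarrow> h (0, t) = x" "\<And>t. t \<in> {0..1} \<Longrightarrow> h (1::real, t) = y"
    unfolding homotopic_loops by blast
  have "path (\<lambda>t. h (t, 0))"
    unfolding path_def
    by (rule continuous_on_compose2[OF h(1)]) (auto intro!: continuous_intros)
  then show "\<exists>g. path g \<and> path_image g \<subseteq> S \<and> pathstart g = x \<and> pathfinish g = y"
    using h by (intro exI[of _ "\<lambda>t. h (t, 0)"]) (auto simp: path_image_def pathstart_def pathfinish_def)
qed

section \<open>The fundamental group and its action\<close>

text \<open>The product is a union over all representatives; homotopic factors have homotopic
  concatenations, so all terms of the union are the same class.\<close>

lemma fundamental_group_mult_path_class:
  assumes "\<gamma> \<in> loops_at X x" "\<delta> \<in> loops_at X x"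
  shows "path_class X \<gamma> \<otimes>\<^bsub>fundamental_group X x\<^esub> path_class X \<delta> = path_class X (\<gamma> +++ \<delta>)"
proof -
  have "path_class X (\<gamma>' +++ \<delta>') = path_class X (\<gamma> +++ \<delta>)"
    if "\<gamma>' \<in> path_class X \<gamma>" "\<delta>' \<in> path_class X \<delta>" for \<gamma>' \<delta>'
  proof -
    have "homotopic_paths X (\<gamma> +++ \<delta>) (\<gamma>' +++ \<delta>')"
      using assms that by (intro homotopic_paths_join) (auto simp: path_class_def loops_at_def)
    then show ?thesis
      unfolding path_class_def using homotopic_paths_trans homotopic_paths_sym by blast
  qed
  \<comment> \<open>Both index sets are nonempty, so the union is not empty.\<close>
  moreover have "\<gamma> \<in> path_class X \<gamma>" "\<delta> \<in> path_class X \<delta>"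
    using assms by (auto simp: path_class_def loops_at_def)
  ultimately have "(\<Union>\<gamma>'\<in>path_class X \<gamma>. \<Union>\<delta>'\<in>path_class X \<delta>. path_class X (\<gamma>' +++ \<delta>')) =
      path_class X (\<gamma> +++ \<delta>)"
    by blast
  then show ?thesis by (simp add: fundamental_group_def)
qed

lemma fundamental_group_m_closed:
  assumes "\<alpha> \<in> carrier (fundamental_group X x)" "\<beta> \<in> carrier (fundamental_group X x)"
  shows "\<alpha> \<otimes>\<^bsub>fundamental_group X x\<^esub> \<beta> \<in> carrier (fundamental_group X x)"
proof -
  obtain \<gamma> \<delta> where \<gamma>: "\<gamma> \<in> loops_at X x" "\<alpha> = path_class X \<gamma>"
    and \<delta>: "\<delta> \<in> loops_at X x" "\<beta> = path_class X \<delta>"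
    using assms by (auto simp: fundamental_group_def)
  have "\<gamma> +++ \<delta> \<in> loops_at X x"
    using \<gamma> \<delta> by (auto simp: loops_at_def path_image_join)
  then show ?thesis
    using fundamental_group_mult_path_class[OF \<gamma>(1) \<delta>(1)] \<gamma> \<delta>
    by (auto simp: fundamental_group_def)
qed

section \<open>Transitivity of the action on fibres\<close>

text \<open>\<open>D \<circ> c\<close> and \<open>c'\<close> lift the same path from the same start,
  so they end at the same point. This propagates a known value of \<open>D\<close> along
  paths.\<close>

lemma covering_transformation_eq_on_paths:
  assumes cov: "covering_space E p X" and D: "covering_transformation E p D"
    and c: "path c" "path_image c \<subseteq> E" and c': "path c'" "path_image c' \<subseteq> E"
    and eq: "\<And>t. t \<in> {0..1} \<Longrightarrow> p (c' t) = p (c t)" and "D (pathstart c) = pathstart c'"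
  shows "D (pathfinish c) = pathfinish c'"
proof -
  have D: "continuous_on E D" "D ` E = E" "\<And>e. e \<in> E \<Longrightarrow> p (D e) = p e"
    using D unfolding covering_transformation_def homeomorphism_def by blast+
  have cE: "c t \<in> E" if "t \<in> {0..1}" for t using that c unfolding path_image_def by blast
  have "pathfinish (D \<circ> c) = pathfinish c'"
  proof (rule covering_space_lift_path_unique[OF cov])
    show "path (D \<circ> c)"
      using c D(1) by (meson continuous_on_subset path_continuous_image)
    show "path_image (D \<circ> c) \<subseteq> E" using c D(2) by (simp add: path_image_compose) blast
    show "p ((D \<circ> c) t) = p (c' t)" if "t \<in> {0..1}" for t
      using that cE D(3) eq by simp
    show "pathstart (D \<circ> c) = pathstart c'" by (simp add: pathstart_compose assms(8))
  qed (use c' in auto)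
  then show ?thesis by (simp add: pathfinish_compose)
qed

text \<open>\<open>covering_action\<close> prescribes the value of \<open>act\<close> only at
  \<open>e0\<close>, so \<open>e\<close> and \<open>e'\<close> are first moved along paths into the
  fibre of \<open>e0\<close>.\<close>

lemma covering_action_transitive_on_fibres:
  assumes uc: "universal_covering E p X" and act: "covering_action E p X e0 act"
    and "e0 \<in> E" "e \<in> E" "e' \<in> E" "p e = p e'"
  shows "\<exists>\<alpha>\<in>carrier (fundamental_group X (p e0)). act \<alpha> e = e'"
proof -
  have cov: "covering_space E p X" and "path_connected E"
    using uc simply_connected_imp_path_connected_top unfolding universal_covering_def by auto
  have p: "continuous_on E p" "p ` E = X" using cov unfolding covering_space_def by auto
  have p_path: "path (p \<circ> c)" "path_image (p \<circ> c) \<subseteq> X" if "path c" "path_image c \<subseteq> E" for c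
  proof -
    show "path (p \<circ> c)" using that p(1) continuous_on_subset path_continuous_image by blast
    show "path_image (p \<circ> c) \<subseteq> X" using that p(2) unfolding path_image_compose by blast
  qed
  obtain c where c: "path c" "path_image c \<subseteq> E" "pathstart c = e" "pathfinish c = e0"
    using \<open>path_connected E\<close> \<open>e \<in> E\<close> \<open>e0 \<in> E\<close> unfolding path_connected_def by blast
  have "p e' = pathstart (p \<circ> c)" using \<open>p e = p e'\<close> c(3) by (simp add: pathstart_compose)
  \<comment> \<open>\<open>c'\<close> copies \<open>c\<close> from the start \<open>e'\<close>, so
    it ends in the fibre of \<open>e0\<close>.\<close>
  then obtain c' where c': "path c'" "path_image c' \<subseteq> E" "pathstart c' = e'"
      "\<And>t. t \<in> {0..1} \<Longrightarrow> p (c' t) = (p \<circ> c) t"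
    using covering_space_lift_path_top[OF cov p_path[OF c(1,2)] \<open>e' \<in> E\<close>] by blast
  have e1: "pathfinish c' \<in> E" "p (pathfinish c') = p e0"
    using c'(2) c'(4)[of 1] c(4) pathfinish_in_path_image[of c'] by (auto simp: pathfinish_def)
  \<comment> \<open>The projection of \<open>\<delta>\<close> is a loop at \<open>p e0\<close> whose
    lift from \<open>e0\<close> ends where \<open>c'\<close> ends; its class is the required
    element.\<close>
  obtain \<delta> where \<delta>: "path \<delta>" "path_image \<delta> \<subseteq> E" "pathstart \<delta> = e0" "pathfinish \<delta> = pathfinish c'"
    using \<open>path_connected E\<close> e1 \<open>e0 \<in> E\<close> unfolding path_connected_def by blast
  let ?\<alpha> = "path_class X (p \<circ> \<delta>)"
  have loop: "p \<circ> \<delta> \<in> loops_at X (p e0)"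
    using p_path[OF \<delta>(1,2)] \<delta>(3,4) e1
    by (simp add: loops_at_def pathstart_compose pathfinish_compose)
  then have \<alpha>: "?\<alpha> \<in> carrier (fundamental_group X (p e0))"
    by (simp add: fundamental_group_def)
  have "p \<circ> \<delta> \<in> ?\<alpha>" using loop by (simp add: path_class_def loops_at_def)
  moreover have act_\<alpha>: "covering_transformation E p (act ?\<alpha>)"
    and "\<And>\<gamma> \<delta>. \<gamma> \<in> ?\<alpha> \<Longrightarrow> path \<delta> \<Longrightarrow> path_image \<delta> \<subseteq> E \<Longrightarrow> pathstart \<delta> = e0 \<Longrightarrow>
      \<forall>t\<in>{0..1}. p (\<delta> t) = \<gamma> t \<Longrightarrow> act ?\<alpha> e0 = pathfinish \<delta>"
    using act \<alpha> unfolding covering_action_def by blast+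
  ultimately have "act ?\<alpha> e0 = pathfinish c'" using \<delta> by (metis comp_apply)
  \<comment> \<open>Running back along \<open>c\<close> and \<open>c'\<close> carries the equation
    from \<open>e0\<close> to \<open>e\<close>.\<close>
  then have "act ?\<alpha> (pathfinish (reversepath c)) = pathfinish (reversepath c')"
  proof (intro covering_transformation_eq_on_paths[OF cov act_\<alpha>])
    show "p (reversepath c' t) = p (reversepath c t)" if "t \<in> {0..1}" for t
      using that c'(4)[of "1 - t"] by (simp add: reversepath_def)
  qed (use c c' in simp_all)
  then have "act ?\<alpha> e = e'" using c c' by simp
  then show ?thesis using \<alpha> by blast
qed

section \<open>Liftings and their classes\<close>

text \<open>If \<open>\<sigma> \<alpha>\<close> sends \<open>j\<close> to \<open>i\<close> and
  \<open>\<sigma> \<gamma>\<close> sends \<open>i\<close> to \<open>a\<close>, then the product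
  \<open>\<gamma>\<alpha>\<close> sends \<open>j\<close> to \<open>a\<close>. So the inverse
  permutation maps \<open>J\<close> into itself, and onto it by finiteness.\<close>

lemma sigma_class_invariant:
  assumes \<sigma>: "\<sigma> \<in> hom G (sym_group n)"
    and closed: "\<And>\<alpha> \<beta>. \<alpha> \<in> carrier G \<Longrightarrow> \<beta> \<in> carrier G \<Longrightarrow> \<alpha> \<otimes>\<^bsub>G\<^esub> \<beta> \<in> carrier G"
    and J: "J \<in> {1..n} // sigma_rel G n \<sigma>" and \<alpha>: "\<alpha> \<in> carrier G"
  shows "inv_into UNIV (\<sigma> \<alpha>) ` J = J"
proof -
  have perm: "\<sigma> \<alpha> permutes {1..n}"
    using \<sigma> \<alpha> by (auto simp: hom_def sym_group_def)
  then have inv_perm: "inv_into UNIV (\<sigma> \<alpha>) permutes {1..n}" by (rule permutes_inv)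
  \<comment> \<open>By the orientation of \<open>sigma_rel\<close>, \<open>J\<close> consists of the
    indices that some \<open>\<sigma> \<gamma>\<close> moves to \<open>a\<close>.\<close>
  obtain a where a: "a \<in> {1..n}" "J = sigma_rel G n \<sigma> `` {a}"
    using J by (auto simp: quotient_def)
  then have "J \<subseteq> {1..n}" by (auto simp: sigma_rel_def)
  have "inv_into UNIV (\<sigma> \<alpha>) ` J \<subseteq> J"
  proof
    fix j assume "j \<in> inv_into UNIV (\<sigma> \<alpha>) ` J"
    then obtain i where i: "i \<in> J" "j = inv_into UNIV (\<sigma> \<alpha>) i" by blast
    then have ji: "\<sigma> \<alpha> j = i" using perm by (simp add: permutes_inverses)
    obtain \<gamma> where \<gamma>: "\<gamma> \<in> carrier G" "\<sigma> \<gamma> i = a" using i a by (auto simp: sigma_rel_def)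
    have "\<sigma> (\<gamma> \<otimes>\<^bsub>G\<^esub> \<alpha>) j = a"
      using hom_mult[OF \<sigma> \<gamma>(1) \<alpha>] \<gamma>(2) ji by (simp add: sym_group_mult)
    moreover have "j \<in> {1..n}"
      using i \<open>J \<subseteq> {1..n}\<close> inv_perm by (metis permutes_in_image subsetD)
    ultimately show "j \<in> J" using a closed[OF \<gamma>(1) \<alpha>] by (auto simp: sigma_rel_def)
  qed
  moreover have "inj_on (inv_into UNIV (\<sigma> \<alpha>)) J"
    using inv_perm by (meson inj_on_subset permutes_inj subset_UNIV)
  moreover have "finite J" using \<open>J \<subseteq> {1..n}\<close> finite_subset by blast
  ultimately show ?thesis by (intro endo_inj_surj)
qed

section \<open>Orbit configuration spaces and descent to \<open>X\<close>\<close>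

text \<open>Serves both to extract the coordinates of a lifting and to assemble the subtuple of a
  class. Points of the product are extensional functions, whence the first conjunct.\<close>

lemma continuous_map_orbit_config_space_iff:
  "continuous_map T (orbit_config_space E p n) F \<longleftrightarrow>
     F ` topspace T \<subseteq> extensional {1..n} \<and>
     (\<forall>i\<in>{1..n}. continuous_map T (top_of_set E) (\<lambda>e. F e i)) \<and>
     (\<forall>e\<in>topspace T. inj_on (\<lambda>i. p (F e i)) {1..n})"
  unfolding orbit_config_space_def continuous_map_in_subtopology continuous_map_componentwise
  by auto

text \<open>The map is \<open>p\<close> in each coordinate followed by passage to orbits. The first
  factor lands in \<open>config_space X n\<close> because the orbit condition demands distinct
  projections.\<close>

lemma continuous_map_orbit_config_proj:
  assumes p: "continuous_on E p" "p ` E \<subseteq> X"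
  shows "continuous_map (orbit_config_space E p n) (unordered_config_space X n) (orbit_config_proj p n)"
proof -
  let ?T = "orbit_config_space E p n"
  \<comment> \<open>The componentwise criterion applied to the identity gives continuity of the
    coordinate projections.\<close>
  have id: "continuous_map ?T ?T (\<lambda>y. y)" by simp
  have "continuous_map ?T (config_space X n) (\<lambda>y. \<lambda>i\<in>{1..n}. p (y i))"
    unfolding config_space_def
  proof (subst continuous_map_in_subtopology, subst continuous_map_componentwise, intro conjI ballI)
    fix i assume i: "i \<in> {1..n}"
    have "continuous_map ?T (top_of_set E) (\<lambda>y. y i)"
      using id i unfolding continuous_map_orbit_config_space_iff by blast
    moreover have "continuous_map (top_of_set E) (top_of_set X) p" using p by auto
    ultimately have "continuous_map ?T (top_of_set X) (p \<circ> (\<lambda>y. y i))"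
      by (rule continuous_map_compose)
    then show "continuous_map ?T (top_of_set X) (\<lambda>y. (\<lambda>i\<in>{1..n}. p (y i)) i)"
      using i by (simp add: o_def)
  next
    show "(\<lambda>y. \<lambda>i\<in>{1..n}. p (y i)) \<in> topspace ?T \<rightarrow> {y. inj_on y {1..n}}"
    proof (intro Pi_I CollectI)
      fix y assume "y \<in> topspace ?T"
      then have "inj_on (\<lambda>i. p (y i)) {1..n}" by (simp add: orbit_config_space_def)
      then show "inj_on (\<lambda>i\<in>{1..n}. p (y i)) {1..n}"
        by (rule subst[OF inj_on_cong, rotated]) simp
    qed
  next
    show "(\<lambda>y. \<lambda>i\<in>{1..n}. p (y i)) ` topspace ?T \<subseteq> extensional {1..n}" by blast
  qed
  then have "continuous_map ?T (unordered_config_space X n)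
      ((\<lambda>y. y ` {1..n}) \<circ> (\<lambda>y. \<lambda>i\<in>{1..n}. p (y i)))"
    unfolding unordered_config_space_def
    using quotient_imp_continuous_map[OF quotient_map_quotient_topology] by (rule continuous_map_compose)
  then show ?thesis
  proof (rule continuous_map_eq)
    show "((\<lambda>y. y ` {1..n}) \<circ> (\<lambda>y. \<lambda>i\<in>{1..n}. p (y i))) y = orbit_config_proj p n y" for y
      unfolding orbit_config_proj_def o_def by (intro image_cong) simp_all
  qed
qed

lemma lifting_descends:
  assumes cov: "covering_space E p X"
    and H: "continuous_map (top_of_set E) (orbit_config_space E p k) H"
    and inv: "\<And>e e'. e \<in> E \<Longrightarrow> e' \<in> E \<Longrightarrow> p e = p e' \<Longrightarrow>
       orbit_config_proj p k (H e) = orbit_config_proj p k (H e')"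
  shows "\<exists>g. multivalued_map X k g \<and> lifting E p k g H"
proof -
  have pE: "continuous_on E p" "p ` E = X" using cov by (auto simp: covering_space_def)
  \<comment> \<open>\<open>inv_into E p x\<close> is an arbitrary point over \<open>x\<close>; by
    \<open>inv\<close> the value does not depend on it.\<close>
  define g where "g x = orbit_config_proj p k (H (inv_into E p x))" for x
  have g: "g (p e) = orbit_config_proj p k (H e)" if "e \<in> E" for e
    unfolding g_def using that by (intro inv) (auto simp: inv_into_into f_inv_into_f)
  have "continuous_map (top_of_set E) (unordered_config_space X k) (orbit_config_proj p k \<circ> H)"
    using H continuous_map_orbit_config_proj[of E p X] pE by (intro continuous_map_compose) auto
  then have "continuous_map (top_of_set E) (unordered_config_space X k) (g \<circ> p)"
    by (rule continuous_map_eq) (simp add: g)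
  then have "multivalued_map X k g"
    unfolding multivalued_map_def
    by (rule continuous_compose_quotient_map[OF covering_space_quotient_map_top[OF cov]])
  then show ?thesis using H g unfolding lifting_def by auto
qed

section \<open>Stability of a \<sigma>-class along fibres\<close>

lemma lifting_sigma_class_fibre_invariant:
  assumes "universal_covering E p X" and "e0 \<in> E" and act: "covering_action E p X e0 act"
    and F: "lifting E p n f F"
    and factors: "lifting_factors E (fundamental_group X (p e0)) act n F \<phi> \<sigma>"
    and J: "J \<in> {1..n} // sigma_rel (fundamental_group X (p e0)) n \<sigma>"
    and e: "e \<in> E" "e' \<in> E" "p e = p e'"
  shows "(\<lambda>i. p (F e i)) ` J = (\<lambda>i. p (F e' i)) ` J"
proof -
  let ?G = "fundamental_group X (p e0)"
  obtain \<alpha> where \<alpha>: "\<alpha> \<in> carrier ?G" "act \<alpha> e = e'"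
    using covering_action_transitive_on_fibres[OF assms(1) act \<open>e0 \<in> E\<close> e] by blast
  let ?s = "inv_into UNIV (\<sigma> \<alpha>)"
  have \<sigma>: "\<sigma> \<in> hom ?G (sym_group n)" and \<phi>: "\<And>i. i \<in> {1..n} \<Longrightarrow> \<phi> i \<alpha> \<in> carrier ?G"
    and fac: "\<And>i. i \<in> {1..n} \<Longrightarrow> F (act \<alpha> e) i = act (\<phi> i \<alpha>) (F e (?s i))"
    using factors \<alpha> e(1) unfolding lifting_factors_def by blast+
  have J_inv: "?s ` J = J"
    by (rule sigma_class_invariant[OF \<sigma> fundamental_group_m_closed J \<alpha>(1)])
  have Jn: "J \<subseteq> {1..n}" using J by (auto simp: quotient_def sigma_rel_def)
  have "p (F e' i) = p (F e (?s i))" if "i \<in> J" for i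
  proof -
    have "?s i \<in> J" using imageI[OF that, of ?s] unfolding J_inv .
    then have i: "i \<in> {1..n}" "?s i \<in> {1..n}" using that Jn by auto
    \<comment> \<open>Continuity places \<open>F e (?s i)\<close> in \<open>E\<close>, where
      covering transformations are known to preserve \<open>p\<close>.\<close>
    have "continuous_map (top_of_set E) (top_of_set E) (\<lambda>e. F e (?s i))"
      using F i(2) unfolding lifting_def continuous_map_orbit_config_space_iff by blast
    from continuous_map_image_subset_topspace[OF this] have "F e (?s i) \<in> E"
      using \<open>e \<in> E\<close> by (simp add: image_subset_iff)
    moreover have "covering_transformation E p (act (\<phi> i \<alpha>))"
      using act \<phi>[OF i(1)] unfolding covering_action_def by blast
    ultimately show ?thesis
      unfolding \<alpha>(2)[symmetric] fac[OF i(1)] covering_transformation_def by blast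
  qed
  then have "(\<lambda>i. p (F e' i)) ` J = (\<lambda>i. p (F e i)) ` (?s ` J)"
    unfolding image_image by (rule image_cong[OF refl])
  then show ?thesis unfolding J_inv by simp
qed

text \<open>Distinct components already have distinct projections at the single point
  \<open>e\<close>. Hence a class of component maps determines its indices.\<close>

lemma inj_on_component_map:
  assumes "lifting E p n f F" "e \<in> E"
  shows "inj_on (component_map E F) {1..n}"
proof (rule inj_onI)
  fix i j assume ij: "i \<in> {1..n}" "j \<in> {1..n}" "component_map E F i = component_map E F j"
  have "F e i = F e j"
    using \<open>e \<in> E\<close> fun_cong[OF ij(3)[unfolded component_map_def], of e] by simp
  then have "p (F e i) = p (F e j)" by simp
  moreover have "inj_on (\<lambda>i. p (F e i)) {1..n}"
    using assms
    unfolding lifting_def continuous_map_orbit_config_space_iff topspace_euclidean_subtopology by blast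
  ultimately show "i = j" using ij(1,2) by (meson inj_onD)
qed

theorem theorem4p2:
  fixes X :: "'a::topological_space set"
    and K :: "'c::euclidean_space set set"
    and E :: "'b::topological_space set"
    and p :: "'b \<Rightarrow> 'a"
    and e0 :: 'b
    and b :: "nat \<Rightarrow> 'b"
    and act :: "(real \<Rightarrow> 'a) set \<Rightarrow> 'b \<Rightarrow> 'b"
    and f :: "'a \<Rightarrow> 'a set"
    and n k :: nat
    and F :: "'b \<Rightarrow> nat \<Rightarrow> 'b"
    and \<phi> :: "nat \<Rightarrow> (real \<Rightarrow> 'a) set \<Rightarrow> (real \<Rightarrow> 'a) set"
    and \<sigma> :: "(real \<Rightarrow> 'a) set \<Rightarrow> nat \<Rightarrow> nat"
    and \<C> :: "('b \<Rightarrow> 'b) set"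
    and idx :: "nat \<Rightarrow> nat"
  assumes "simplicial_complex K" and "X homeomorphic \<Union>K" and "connected X"
    and "universal_covering E p X" and "e0 \<in> E"
    and "covering_action E p X e0 act"
    and "multivalued_map X n f"
    and "b \<in> topspace (orbit_config_space E p n)"
    and "orbit_config_proj p n b = f (p e0)"
    and "basic_lifting E p n e0 b f F"
    and "lifting_factors E (fundamental_group X (p e0)) act n F \<phi> \<sigma>"
    and "\<C> \<in> sigma_classes E (fundamental_group X (p e0)) n \<sigma> F"
    and "idx \<in> {1..k} \<rightarrow> {1..n}"
    and "bij_betw (\<lambda>l. component_map E F (idx l)) {1..k} \<C>"
  shows "\<exists>g. submap X n f k g \<and> lifting E p k g (\<lambda>e. \<lambda>l\<in>{1..k}. F e (idx l))"
proof -
  have cov: "covering_space E p X" using assms(4) by (simp add: universal_covering_def)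
  have F: "lifting E p n f F" using assms(10) by (simp add: basic_lifting_def)
  obtain J where J: "J \<in> {1..n} // sigma_rel (fundamental_group X (p e0)) n \<sigma>"
    and C: "\<C> = component_map E F ` J"
    using assms(12) by (auto simp: sigma_classes_def)
  have Jn: "J \<subseteq> {1..n}" using J by (auto simp: quotient_def sigma_rel_def)
  have idx_n: "idx ` {1..k} \<subseteq> {1..n}" using assms(13) by blast
  \<comment> \<open>The class is enumerated as a set of maps; injectivity of
    \<open>component_map E F\<close> on \<open>{1..n}\<close> turns this into an enumeration of the
    index set \<open>J\<close>.\<close>
  have "component_map E F ` (idx ` {1..k}) = component_map E F ` J"
    using assms(14) C by (simp add: bij_betw_def image_image)
  then have idx_J: "idx ` {1..k} = J"
    using inj_on_image_eq_iff[OF inj_on_component_map[OF F \<open>e0 \<in> E\<close>] idx_n Jn] by blast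
  have "inj_on (component_map E F \<circ> idx) {1..k}"
    using assms(14) unfolding bij_betw_def o_def by blast
  then have idx_inj: "inj_on idx {1..k}" by (rule inj_on_imageI2)
  have "k \<le> n"
    using card_inj_on_le[OF idx_inj idx_n] by simp
  let ?H = "\<lambda>e. \<lambda>l\<in>{1..k}. F e (idx l)"
  \<comment> \<open>The unordered set of projected values depends only on \<open>J\<close>, not on
    the enumeration \<open>idx\<close>.\<close>
  have proj: "orbit_config_proj p k (?H e) = (\<lambda>i. p (F e i)) ` J" for e
    unfolding orbit_config_proj_def idx_J[symmetric] image_image by (rule image_cong) auto
  have "continuous_map (top_of_set E) (orbit_config_space E p k) ?H"
    unfolding continuous_map_orbit_config_space_iff
  proof (intro conjI ballI)
    fix l assume l: "l \<in> {1..k}"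
    then have "continuous_map (top_of_set E) (top_of_set E) (\<lambda>e. F e (idx l))"
      using F idx_n unfolding lifting_def continuous_map_orbit_config_space_iff by blast
    then show "continuous_map (top_of_set E) (top_of_set E) (\<lambda>e. ?H e l)"
      using l by simp
  next
    fix e assume "e \<in> topspace (top_of_set E)"
    then have "inj_on (\<lambda>i. p (F e i)) {1..n}"
      using F unfolding lifting_def continuous_map_orbit_config_space_iff by blast
    then have "inj_on ((\<lambda>i. p (F e i)) \<circ> idx) {1..k}"
      using idx_inj idx_n by (meson comp_inj_on inj_on_subset)
    then show "inj_on (\<lambda>l. p (?H e l)) {1..k}"
      by (rule subst[OF inj_on_cong, rotated]) simp
  qed auto
  moreover have "orbit_config_proj p k (?H e) = orbit_config_proj p k (?H e')"
    if "e \<in> E" "e' \<in> E" "p e = p e'" for e e'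
    unfolding proj
    by (rule lifting_sigma_class_fibre_invariant[OF assms(4,5,6) F assms(11) J that])
  ultimately obtain g where g: "multivalued_map X k g" "lifting E p k g ?H"
    using lifting_descends[OF cov] by blast
  have "g x \<subseteq> f x" if "x \<in> X" for x
  proof -
    \<comment> \<open>Over a point \<open>e\<close> of the fibre, the values of \<open>g\<close> are
      those indexed by \<open>J\<close>, and the values of \<open>f\<close> those indexed by all of
      \<open>{1..n}\<close>.\<close>
    obtain e where e: "e \<in> E" "x = p e"
      using \<open>x \<in> X\<close> covering_space_imp_surjective[OF cov] by blast
    have "g x = (\<lambda>i. p (F e i)) ` J" using g(2) e proj by (simp add: lifting_def)
    also have "\<dots> \<subseteq> orbit_config_proj p n (F e)" using Jn by (auto simp: orbit_config_proj_def)
    also have "\<dots> = f x" using F e by (simp add: lifting_def)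
    finally show ?thesis .
  qed
  then show ?thesis using g \<open>k \<le> n\<close> unfolding submap_def by blast
qed

end
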